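(* Let $(X,X_+,\mathcal K,f)$ be an abstract state space, $P\neq I$ a projection on $X$, and $T\in\Sigma_P(X)$. Then $T$ is uniformly $P$-ergodic if and only if $TP=P$ and there exists $n_0\in\mathbb N$ such that $\delta_P(T^{n_0})<1$. Moreover, in this case there are constants $C,\alpha>0$ and $n_0\in\mathbb N$ such that $$\|T^n-P\|\le C e^{-\alpha n}\qquad\text{for all } n\ge n_0.$$
   Context: Let $X$ be a real ordered vector space with generating cone $X_+$ ($X=X_+-X_+$), let $f$ be a strictly positive linear functional on $X$ ($f(x)>0$ for $x>0$), and let $\mathcal K=\{x\in X_+: f(x)=1\}$. Let $U$ be the convex hull of $\mathcal K\cup(-\mathcal K)$ and $\|x\|=\inf\{t\ge 0: x\in tU\}$. $(X,X_+,\mathcal K,f)$ is an abstract state space if this seminorm is a norm, $X$ is complete for it, and $X_+$ is closed; $X$ always carries this norm. A linear operator $T:X\to X$ is Markov if it is positive and $T(\mathcal K)\subset\mathcal K$; $\Sigma(X)$ is the set of Markov operators. A projection is a bounded linear operator $P:X\to X$ with $P^2=P$; $\Sigma_P(X)=\{T\in\Sigma(X): TP=PT\}$. For a projection $P\ne I$ and a bounded linear operator $T$, $\delta_P(T)=\sup\{\|Tx\|/\|x\| : Px=0,\ x\ne0\}$. A bounded operator $T$ is uniformly $P$-ergodic if $\|T^n-P\|\to0$ as $n\to\infty$. $\mathbb N=\{1,2,\dots\}$. *)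

theory Defs
  imports "HOL-Analysis.Analysis"
begin

definition base :: "('a::ordered_real_vector \<Rightarrow> real) \<Rightarrow> 'a set" where
  "base f = {x. 0 \<le> x \<and> f x = 1}"

definition base_ball :: "('a::ordered_real_vector \<Rightarrow> real) \<Rightarrow> 'a set" where
  "base_ball f = convex hull (base f \<union> uminus ` base f)"

definition base_norm :: "('a::ordered_real_vector \<Rightarrow> real) \<Rightarrow> 'a \<Rightarrow> real" where
  "base_norm f x = Inf {t. 0 \<le> t \<and> x \<in> (*\<^sub>R) t ` base_ball f}"

text \<open>
  The space is a whole type with cone \<open>{x. 0 \<le> x}\<close>. That the gauge of \<open>base_ball f\<close> is a norm,
  and that the space is complete for it, is expressed by requiring it to be the norm of the
  class \<open>banach\<close>; closedness and operator norms then refer to that norm.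
\<close>

definition abstract_state_space ::
    "('a::{banach, ordered_real_vector} \<Rightarrow> real) \<Rightarrow> bool" where
  "abstract_state_space f \<longleftrightarrow>
     linear f \<and> (\<forall>x>0. f x > 0) \<and>
     (\<forall>x::'a. \<exists>y\<ge>0. \<exists>z\<ge>0. x = y - z) \<and>
     (\<forall>x. norm x = base_norm f x) \<and>
     closed {x::'a. 0 \<le> x}"

definition Markov_operators ::
    "('a::ordered_real_vector \<Rightarrow> real) \<Rightarrow> ('a \<Rightarrow> 'a) set" where
  "Markov_operators f =
     {T. linear T \<and> (\<forall>x. 0 \<le> x \<longrightarrow> 0 \<le> T x) \<and> T ` base f \<subseteq> base f}"

definition Markov_operators_commuting ::
    "('a::ordered_real_vector \<Rightarrow> real) \<Rightarrow> ('a \<Rightarrow> 'a) \<Rightarrow> ('a \<Rightarrow> 'a) set" where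
  "Markov_operators_commuting f P = {T \<in> Markov_operators f. T \<circ> P = P \<circ> T}"

definition projection :: "('a::real_normed_vector \<Rightarrow> 'a) \<Rightarrow> bool" where
  "projection P \<longleftrightarrow> bounded_linear P \<and> P \<circ> P = P"

text \<open>
  Only meaningful for \<open>P \<noteq> id\<close> and bounded linear \<open>T\<close>: the supremum is then over a nonempty set
  that is bounded above.
\<close>

definition ergodicity_coeff ::
    "('a::real_normed_vector \<Rightarrow> 'a) \<Rightarrow> ('a \<Rightarrow> 'a) \<Rightarrow> real" where
  "ergodicity_coeff P T = (SUP x\<in>{x. P x = 0 \<and> x \<noteq> 0}. norm (T x) / norm x)"

definition uniformly_ergodic ::
    "('a::real_normed_vector \<Rightarrow> 'a) \<Rightarrow> ('a \<Rightarrow> 'a) \<Rightarrow> bool" where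
  "uniformly_ergodic P T \<longleftrightarrow>
     bounded_linear T \<and> (\<lambda>n. onorm (\<lambda>x. (T ^^ n) x - P x)) \<longlonglongrightarrow> 0"

end

theory Submission imports Defs begin

text \<open>
  Positivity enters only through one fact: a Markov operator maps the set \<open>base_ball f\<close>, whose gauge
  is the norm, into itself, so it is a contraction (\<open>Markov_operator_norm_le\<close>). The rest is an argument about a
  contraction \<open>T\<close> that commutes with a projection \<open>P\<close> on a normed space.

  If \<open>T ^^ n\<close> converges to \<open>P\<close>, then comparing the limits of \<open>(T ^^ Suc n) (P x)\<close> and
  \<open>T ((T ^^ n) (P x))\<close> gives \<open>T \<circ> P = P\<close>. Since \<open>T ^^ n\<close> and \<open>T ^^ n - P\<close> agree on the kernel
  of \<open>P\<close>, the coefficient of \<open>T ^^ n\<close> is at most the operator norm of \<open>T ^^ n - P\<close>, which is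
  eventually below 1.

  Conversely, \<open>T \<circ> P = P\<close> gives \<open>T ^^ n - P = T ^^ n \<circ> (I - P)\<close>, and \<open>I - P\<close> maps into the kernel
  of \<open>P\<close>, which \<open>T\<close> preserves. Each block of \<open>n\<^sub>0\<close> applications of \<open>T\<close> shrinks vectors of the
  kernel by the factor \<open>ergodicity_coeff P (T ^^ n\<^sub>0) < 1\<close>, and the remaining applications do not
  increase the norm. This gives geometric decay of \<open>T ^^ n - P\<close>
  (\<open>onorm_iterate_diff_exponential_decay\<close>), hence both the converse and the rate.
\<close>

text \<open>
  This provides a point in the set of \<open>t\<close> over which the gauge takes its infimum; the infimum of
  the empty set of reals is an unspecified number, about which nothing could be proved.

  Normalising \<open>y\<close> and \<open>z\<close> to points of the base exhibits \<open>x / (f y + f z)\<close> as a convex combination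
  of a point of \<open>base f\<close> and one of \<open>- base f\<close>. If \<open>y\<close> or \<open>z\<close> vanishes, it has weight 0 and any
  point of the base can stand in for its normalisation.
\<close>

lemma base_ball_absorbing:
  fixes f :: "'a::ordered_real_vector \<Rightarrow> real"
  assumes "linear f" and pos: "\<And>x. x > 0 \<Longrightarrow> f x > 0"
    and x: "x = y - z" "0 \<le> y" "0 \<le> z" "x \<noteq> 0"
  shows "\<exists>t\<ge>0. x \<in> (*\<^sub>R) t ` base_ball f"
proof -
  have normalise: "(1 / f v) *\<^sub>R v \<in> base f" if "0 \<le> v" "v \<noteq> 0" for v
    using pos[of v] that
    by (auto simp: base_def linear_cmul[OF \<open>linear f\<close>] less_le intro!: scaleR_nonneg_nonneg)
  have "base f \<noteq> {}"
    using normalise[of y] normalise[of z] x by fastforce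
  have decompose: "\<exists>k\<in>base f. v = f v *\<^sub>R k \<and> 0 \<le> f v" if "0 \<le> v" for v
  proof (cases "v = 0")
    case True
    then show ?thesis
      using \<open>base f \<noteq> {}\<close> linear_0[OF \<open>linear f\<close>] by auto
  next
    case False
    then show ?thesis
      using pos[of v] normalise[of v] that by (intro bexI[of _ "(1 / f v) *\<^sub>R v"]) (auto simp: less_le)
  qed
  obtain k l where k: "k \<in> base f" "y = f y *\<^sub>R k" "0 \<le> f y"
    and l: "l \<in> base f" "z = f z *\<^sub>R l" "0 \<le> f z"
    using decompose x by meson
  define t where "t = f y + f z"
  have "t \<noteq> 0"
    using k l x unfolding t_def by (metis add_nonneg_eq_0_iff diff_self scaleR_zero_left)
  then have "t > 0" using k l unfolding t_def by linarith
  have "(f y / t) *\<^sub>R k + (f z / t) *\<^sub>R (- l) \<in> base_ball f"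
    unfolding base_ball_def
    by (rule convexD[OF convex_convex_hull])
      (use k l \<open>t > 0\<close> in \<open>auto simp: t_def add_divide_distrib[symmetric] intro!: hull_inc\<close>)
  moreover have "x = t *\<^sub>R ((f y / t) *\<^sub>R k + (f z / t) *\<^sub>R (- l))"
    using \<open>t > 0\<close> k(2) l(2) x(1) by (simp add: scaleR_right_diff_distrib)
  ultimately show ?thesis using \<open>t > 0\<close> by (intro exI[of _ t]) auto
qed

lemma Markov_operator_base_ball:
  assumes "T \<in> Markov_operators f"
  shows "T ` base_ball f \<subseteq> base_ball f"
proof -
  have T: "linear T" "T ` base f \<subseteq> base f"
    using assms by (auto simp: Markov_operators_def)
  then have "T ` (base f \<union> uminus ` base f) \<subseteq> base f \<union> uminus ` base f"
    by (auto simp: linear_neg)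
  then show ?thesis
    unfolding base_ball_def convex_hull_linear_image[OF T(1)] by (rule hull_mono)
qed

lemma Markov_operator_norm_le:
  fixes f :: "'a::{banach, ordered_real_vector} \<Rightarrow> real"
  assumes f: "abstract_state_space f" and T: "T \<in> Markov_operators f"
  shows "norm (T x) \<le> norm x"
proof (cases "x = 0")
  case True
  then show ?thesis using T by (simp add: Markov_operators_def linear_0)
next
  case False
  have "linear T" using T by (simp add: Markov_operators_def)
  have "\<exists>t\<ge>0. x \<in> (*\<^sub>R) t ` base_ball f"
  proof -
    obtain y z where "0 \<le> y" "0 \<le> z" "x = y - z"
      using f unfolding abstract_state_space_def by blast
    with f False show ?thesis
      unfolding abstract_state_space_def by (intro base_ball_absorbing[of f x y z]) auto
  qed
  then have "{t. 0 \<le> t \<and> x \<in> (*\<^sub>R) t ` base_ball f} \<noteq> {}" by blast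
  moreover have "{t. 0 \<le> t \<and> x \<in> (*\<^sub>R) t ` base_ball f} \<subseteq> {t. 0 \<le> t \<and> T x \<in> (*\<^sub>R) t ` base_ball f}"
    using Markov_operator_base_ball[OF T] by (fastforce simp: linear_cmul[OF \<open>linear T\<close>])
  ultimately have "base_norm f (T x) \<le> base_norm f x"
    unfolding base_norm_def by (intro cInf_superset_mono) (auto intro: bdd_belowI[of _ 0])
  with f show ?thesis by (simp add: abstract_state_space_def)
qed

lemma funpow_norm_le:
  fixes T :: "'a::real_normed_vector \<Rightarrow> 'a"
  assumes "\<And>x. norm (T x) \<le> norm x"
  shows "norm ((T ^^ n) x) \<le> norm x"
  by (induction n) (auto intro: order_trans[OF assms])

lemma linear_funpow:
  fixes T :: "'a::real_vector \<Rightarrow> 'a"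
  assumes "linear T"
  shows "linear (T ^^ n)"
proof (induction n)
  case 0
  show ?case by (simp add: linear_iff)
next
  case (Suc n)
  show ?case using linear_compose[OF Suc assms] by (simp only: funpow.simps)
qed

lemma funpow_commute_apply:
  assumes "T \<circ> P = P \<circ> T"
  shows "(T ^^ n) (P x) = P ((T ^^ n) x)"
  using assms by (induction n) (simp_all add: fun_eq_iff)

lemma funpow_fixes_range:
  assumes "T \<circ> P = P"
  shows "(T ^^ n) (P x) = P x"
  using assms by (induction n) (simp_all add: fun_eq_iff)

text \<open>
  An upper bound for all the quotients is needed because a supremum of an unbounded set of reals
  carries no information; a contraction has the bound 1.
\<close>

lemma norm_le_ergodicity_coeff:
  fixes S :: "'a::real_normed_vector \<Rightarrow> 'a"
  assumes S: "\<And>x. norm (S x) \<le> norm x" and "P x = 0"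
  shows "norm (S x) \<le> ergodicity_coeff P S * norm x"
proof (cases "x = 0")
  case True
  then show ?thesis using S[of 0] by simp
next
  case False
  have "norm (S x) / norm x \<le> ergodicity_coeff P S"
    unfolding ergodicity_coeff_def
  proof (rule cSUP_upper)
    show "bdd_above ((\<lambda>x. norm (S x) / norm x) ` {x. P x = 0 \<and> x \<noteq> 0})"
      using S by (auto intro!: bdd_aboveI[of _ 1] simp: divide_le_eq_1)
  qed (use False assms in auto)
  then show ?thesis using False by (simp add: divide_le_eq)
qed

text \<open>
  On the kernel of \<open>P\<close> the operators \<open>S\<close> and \<open>S - P\<close> agree. The kernel is nonzero because it
  contains \<open>x - P x\<close> for every \<open>x\<close>, and \<open>P \<noteq> id\<close>.
\<close>

lemma ergodicity_coeff_le_onorm_diff: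
  fixes P S :: "'a::real_normed_vector \<Rightarrow> 'a"
  assumes P: "projection P" "P \<noteq> id" and "bounded_linear S"
  shows "ergodicity_coeff P S \<le> onorm (\<lambda>x. S x - P x)"
  unfolding ergodicity_coeff_def
proof (rule cSUP_least)
  obtain x where "P x \<noteq> x" using P(2) by fastforce
  moreover have "P (x - P x) = 0"
    using P(1) by (simp add: projection_def linear_diff bounded_linear.linear fun_eq_iff)
  ultimately show "{x. P x = 0 \<and> x \<noteq> 0} \<noteq> {}" by force
next
  fix x assume x: "x \<in> {x. P x = 0 \<and> x \<noteq> 0}"
  have "bounded_linear (\<lambda>x. S x - P x)"
    using assms by (auto simp: projection_def intro: bounded_linear_sub)
  from le_onorm[OF this, of x] x show "norm (S x) / norm x \<le> onorm (\<lambda>x. S x - P x)" by simp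
qed

lemma uniformly_ergodic_imp_fixes_range:
  fixes P T :: "'a::real_normed_vector \<Rightarrow> 'a"
  assumes P: "projection P" and erg: "uniformly_ergodic P T"
    and powers: "\<And>n. bounded_linear (T ^^ n)"
  shows "T \<circ> P = P"
proof
  fix x
  have "bounded_linear T" using erg by (simp add: uniformly_ergodic_def)
  have lim: "(\<lambda>n. (T ^^ n) (P x)) \<longlonglongrightarrow> P x"
  proof -
    have "norm ((T ^^ n) (P x) - P x) \<le> onorm (\<lambda>x. (T ^^ n) x - P x) * norm (P x)" for n
    proof -
      have "bounded_linear (\<lambda>x. (T ^^ n) x - P x)"
        using P powers by (auto simp: projection_def intro: bounded_linear_sub)
      from onorm[OF this, of "P x"] show ?thesis
        using P by (simp add: projection_def fun_eq_iff)
    qed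
    moreover have "(\<lambda>n. onorm (\<lambda>x. (T ^^ n) x - P x) * norm (P x)) \<longlonglongrightarrow> 0"
      using erg by (auto simp: uniformly_ergodic_def intro: tendsto_mult_left_zero)
    ultimately have "(\<lambda>n. (T ^^ n) (P x) - P x) \<longlonglongrightarrow> 0"
      by (rule Lim_null_comparison[OF always_eventually[OF allI]])
    then show ?thesis by (simp add: LIM_zero_iff)
  qed
  have "(\<lambda>n. T ((T ^^ n) (P x))) \<longlonglongrightarrow> T (P x)"
    using bounded_linear.tendsto[OF \<open>bounded_linear T\<close> lim] .
  moreover have "(\<lambda>n. T ((T ^^ n) (P x))) \<longlonglongrightarrow> P x"
    using LIMSEQ_Suc[OF lim] by simp
  ultimately show "(T \<circ> P) x = P x" using LIMSEQ_unique by auto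
qed

text \<open>
  Splitting \<open>n = r + m * (n div m)\<close> with \<open>r = n mod m\<close>: every full block of \<open>m\<close> applications contributes
  the factor \<open>\<delta>\<close>, and the last \<open>r\<close> applications are absorbed by the contraction property.
\<close>

lemma funpow_norm_le_power_on_kernel:
  fixes P T :: "'a::real_normed_vector \<Rightarrow> 'a"
  assumes T: "\<And>x. norm (T x) \<le> norm x" and comm: "T \<circ> P = P \<circ> T"
    and \<delta>: "ergodicity_coeff P (T ^^ m) \<le> \<delta>" "0 \<le> \<delta>" and x: "P x = 0"
  shows "norm ((T ^^ n) x) \<le> \<delta> ^ (n div m) * norm x"
proof -
  have "T 0 = 0" using T[of 0] by simp
  then have T0: "(T ^^ k) 0 = 0" for k
    by (induction k) auto
  have blocks: "norm ((T ^^ (m * k)) x) \<le> \<delta> ^ k * norm x" for k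
  proof (induction k)
    case (Suc k)
    define y where "y = (T ^^ (m * k)) x"
    have "P y = 0"
      unfolding y_def using funpow_commute_apply[OF comm, of "m * k" x] T0 x by simp
    have "norm ((T ^^ (m * Suc k)) x) = norm ((T ^^ m) y)"
      unfolding y_def by (simp add: funpow_add)
    also have "\<dots> \<le> ergodicity_coeff P (T ^^ m) * norm y"
      using norm_le_ergodicity_coeff[of "T ^^ m" P y] funpow_norm_le[of T] T \<open>P y = 0\<close> by blast
    also have "\<dots> \<le> \<delta> * (\<delta> ^ k * norm x)"
      using Suc \<delta> unfolding y_def by (intro order_trans[OF mult_right_mono mult_left_mono]) auto
    finally show ?case by (simp add: mult.assoc)
  qed simp
  have "(T ^^ n) x = (T ^^ (n mod m)) ((T ^^ (m * (n div m))) x)"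
    by (metis comp_apply funpow_add mod_mult_div_eq)
  then show ?thesis
    using funpow_norm_le[of T, OF T] blocks order_trans by metis
qed

lemma onorm_iterate_diff_exponential_decay:
  fixes P T :: "'a::real_normed_vector \<Rightarrow> 'a"
  assumes T: "\<And>x. norm (T x) \<le> norm x" "linear T" and P: "projection P"
    and comm: "T \<circ> P = P \<circ> T" and TP: "T \<circ> P = P"
    and m: "m \<ge> 1" "ergodicity_coeff P (T ^^ m) < 1"
  shows "\<exists>C \<alpha>. C > 0 \<and> \<alpha> > 0 \<and>
           (\<forall>n. onorm (\<lambda>x. (T ^^ n) x - P x) \<le> C * exp (- \<alpha> * real n))"
proof -
  have "bounded_linear P" and PP: "\<And>x. P (P x) = P x"
    using P by (auto simp: projection_def fun_eq_iff)
  \<comment> \<open>The coefficient itself may be 0, which has no logarithm, so it is replaced by a positive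
    number below 1.\<close>
  define \<delta> where "\<delta> = max (ergodicity_coeff P (T ^^ m)) (1/2)"
  have \<delta>: "0 < \<delta>" "\<delta> < 1" using m by (auto simp: \<delta>_def)
  define \<alpha> where "\<alpha> = - ln \<delta> / m"
  define B where "B = onorm (\<lambda>x. x - P x)"
  have IP: "bounded_linear (\<lambda>x. x - P x)"
    using bounded_linear_sub[OF bounded_linear_ident \<open>bounded_linear P\<close>] .
  then have "B \<ge> 0" unfolding B_def by (rule onorm_pos_le)
  have "\<alpha> > 0" using \<delta> m by (simp add: \<alpha>_def divide_neg_pos)
  have rate: "\<delta> ^ (n div m) \<le> exp (- \<alpha> * n) / \<delta>" for n
  proof -
    \<comment> \<open>Rounding \<open>n / m\<close> down loses less than one block, which costs the factor \<open>1 / \<delta>\<close>.\<close>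
    have "n \<le> m * (n div m) + m"
      using m(1) mod_less_divisor[of m n] mult_div_mod_eq[of m n] by linarith
    then have "n \<le> m * (n div m + 1)" by simp
    then have "real n \<le> real (m * (n div m + 1))" by (simp only: of_nat_le_iff)
    also have "\<dots> = real m * (real (n div m) + 1)" by (simp only: of_nat_mult of_nat_add of_nat_1)
    finally have "real n \<le> real m * (real (n div m) + 1)" .
    then have "real n / m \<le> real (n div m) + 1"
      using m(1) by (simp add: divide_le_eq mult.commute)
    then have "ln \<delta> * (real (n div m) + 1) \<le> ln \<delta> * (real n / m)"
      using \<delta> by (intro mult_left_mono_neg) auto
    also have "\<dots> = - \<alpha> * n" by (simp add: \<alpha>_def)
    finally have "exp (ln \<delta> * (n div m) + ln \<delta>) \<le> exp (- \<alpha> * n)" by (simp add: distrib_left)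
    then have "\<delta> ^ (n div m) * \<delta> \<le> exp (- \<alpha> * n)"
      using \<delta> by (simp add: exp_add exp_of_nat2_mult)
    then show ?thesis using \<delta> by (simp add: pos_le_divide_eq)
  qed
  have "onorm (\<lambda>x. (T ^^ n) x - P x) \<le> (B + 1) / \<delta> * exp (- \<alpha> * real n)" for n
  proof (rule onorm_bound)
    show "0 \<le> (B + 1) / \<delta> * exp (- \<alpha> * real n)"
      using \<open>B \<ge> 0\<close> \<delta> by simp
  next
    fix x
    have "P (x - P x) = 0"
      using PP by (simp add: linear_diff[OF bounded_linear.linear[OF \<open>bounded_linear P\<close>]])
    moreover have "(T ^^ n) x - P x = (T ^^ n) (x - P x)"
      using funpow_fixes_range[OF TP] by (simp add: linear_diff[OF linear_funpow[OF T(2)]])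
    ultimately have "norm ((T ^^ n) x - P x) \<le> \<delta> ^ (n div m) * norm (x - P x)"
      using funpow_norm_le_power_on_kernel[of T P m \<delta> "x - P x" n] T(1) comm \<delta>
      by (simp add: \<delta>_def)
    also have "\<dots> \<le> (exp (- \<alpha> * n) / \<delta>) * ((B + 1) * norm x)"
    proof (rule mult_mono[OF rate])
      show "norm (x - P x) \<le> (B + 1) * norm x"
        using onorm[OF IP, of x] by (simp add: B_def distrib_right add_increasing2)
    qed (use \<delta> in auto)
    finally show "norm ((T ^^ n) x - P x) \<le> (B + 1) / \<delta> * exp (- \<alpha> * real n) * norm x"
      by (simp add: mult_ac)
  qed
  then show ?thesis
    using \<open>B \<ge> 0\<close> \<open>\<alpha> > 0\<close> \<delta> by (intro exI[of _ "(B + 1) / \<delta>"] exI[of _ \<alpha>]) auto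
qed

theorem corollary4p7:
  fixes f :: "'a::{banach, ordered_real_vector} \<Rightarrow> real"
    and P T :: "'a \<Rightarrow> 'a"
  assumes "abstract_state_space f"
    and "projection P" and "P \<noteq> id"
    and "T \<in> Markov_operators_commuting f P"
  shows "(uniformly_ergodic P T \<longleftrightarrow>
            T \<circ> P = P \<and> (\<exists>n0::nat. n0 \<ge> 1 \<and> ergodicity_coeff P (T ^^ n0) < 1)) \<and>
         (uniformly_ergodic P T \<longrightarrow>
            (\<exists>(C::real) (\<alpha>::real) (n0::nat). C > 0 \<and> \<alpha> > 0 \<and> n0 \<ge> 1 \<and>
               (\<forall>n\<ge>n0. onorm (\<lambda>x. (T ^^ n) x - P x) \<le> C * exp (- \<alpha> * real n))))"
proof -
  have T: "T \<in> Markov_operators f" "linear T" and comm: "T \<circ> P = P \<circ> T"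
    using assms(4) by (auto simp: Markov_operators_commuting_def Markov_operators_def)
  have contraction: "norm (T x) \<le> norm x" for x
    by (rule Markov_operator_norm_le[OF assms(1) T(1)])
  have powers: "bounded_linear (T ^^ n)" for n
  proof -
    have "norm ((T ^^ n) x) \<le> norm x * 1" for x
      using funpow_norm_le[of T, OF contraction] by simp
    then show ?thesis
      using linear_funpow[OF T(2)] unfolding linear_conv_bounded_linear[symmetric] bounded_linear_def
        bounded_linear_axioms_def by blast
  qed
  have criterion: "T \<circ> P = P \<and> (\<exists>n0\<ge>1. ergodicity_coeff P (T ^^ n0) < 1)"
    if erg: "uniformly_ergodic P T"
  proof
    show "T \<circ> P = P"
      by (rule uniformly_ergodic_imp_fixes_range[OF assms(2) erg powers])
    have "\<forall>\<^sub>F n in sequentially. onorm (\<lambda>x. (T ^^ n) x - P x) < 1"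
      using erg by (auto simp: uniformly_ergodic_def intro: order_tendstoD(2))
    then obtain N where "\<forall>n\<ge>N. onorm (\<lambda>x. (T ^^ n) x - P x) < 1"
      by (auto simp: eventually_sequentially)
    then have "ergodicity_coeff P (T ^^ max 1 N) < 1"
      using ergodicity_coeff_le_onorm_diff[OF assms(2,3) powers]
      by (meson max.cobounded2 order_le_less_trans)
    then show "\<exists>n0\<ge>1. ergodicity_coeff P (T ^^ n0) < 1"
      using max.cobounded1 by blast
  qed
  have decay: "\<exists>C \<alpha>. C > 0 \<and> \<alpha> > 0 \<and>
      (\<forall>n. onorm (\<lambda>x. (T ^^ n) x - P x) \<le> C * exp (- \<alpha> * real n))"
    if "T \<circ> P = P \<and> (\<exists>n0\<ge>1. ergodicity_coeff P (T ^^ n0) < 1)"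
    using onorm_iterate_diff_exponential_decay[OF contraction T(2) assms(2) comm] that by blast
  have "uniformly_ergodic P T"
    if crit: "T \<circ> P = P \<and> (\<exists>n0\<ge>1. ergodicity_coeff P (T ^^ n0) < 1)"
  proof -
    obtain C \<alpha> where "\<alpha> > 0"
      and le: "\<And>n. onorm (\<lambda>x. (T ^^ n) x - P x) \<le> C * exp (- \<alpha> * real n)"
      using decay[OF crit] by blast
    have "exp (- \<alpha>) < 1" using \<open>\<alpha> > 0\<close> by simp
    then have "(\<lambda>n. C * exp (- \<alpha>) ^ n) \<longlonglongrightarrow> 0"
      by (intro tendsto_mult_right_zero LIMSEQ_realpow_zero) auto
    then have lim: "(\<lambda>n. C * exp (- \<alpha> * real n)) \<longlonglongrightarrow> 0"
      by (simp add: exp_of_nat2_mult[symmetric])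
    have "0 \<le> onorm (\<lambda>x. (T ^^ n) x - P x)" for n
      using assms(2) powers by (auto simp: projection_def intro!: onorm_pos_le bounded_linear_sub)
    then have "norm (onorm (\<lambda>x. (T ^^ n) x - P x)) \<le> C * exp (- \<alpha> * real n)" for n
      using le[of n] by (simp only: real_norm_def abs_of_nonneg)
    then have "(\<lambda>n. onorm (\<lambda>x. (T ^^ n) x - P x)) \<longlonglongrightarrow> 0"
      by (rule Lim_null_comparison[OF always_eventually[OF allI] lim])
    then show ?thesis
      using powers[of 1] by (simp add: uniformly_ergodic_def)
  qed
  then show ?thesis using criterion decay by blast
qed

end
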